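(* For every $k\geq1$ there is a bipartite graph $G$ such that $\mathrm{stw}(G)\leq\mathrm{tw}(G)+1\leq k+1\leq \mathrm{ca}_f(G)=i(G)$.
   Context: All graphs are finite and simple. A $k$-tree is obtained from a $(k+1)$-clique by repeatedly adding a new vertex adjacent exactly to some $k$-clique of the current graph; $\mathrm{tw}(G)$ is the minimum $k$ such that $G$ is a subgraph of a $k$-tree. A simple $k$-tree is a $k$-tree with such a construction sequence in which no two vertices are added onto the same $k$-clique; $\mathrm{stw}(G)$ is the minimum $k$ such that $G$ is a subgraph of a simple $k$-tree. For a graph class $\mathcal{T}$ closed under disjoint union, the folded covering number $c_f^{\mathcal T}(G)$ is the minimum, over all edge-surjective graph homomorphisms $\varphi:T\to G$ with $T\in\mathcal{T}$, of $\max_{v\in V(G)}|\varphi^{-1}(v)|$ (equivalently: the least $k$ such that each vertex can be split into at most $k$ vertices, distributing its incident edges among them, possibly repeatedly, so that the result lies in $\mathcal{T}$). A caterpillar is a tree whose non-leaf vertices form a path; $\mathrm{ca}_f(G)=c_f^{\mathcal{Ca}}(G)$ with $\mathcal{Ca}$ the class of caterpillar forests, and the interval-number is $i(G)=c_f^{\mathcal I}(G)$ with $\mathcal I$ the class of interval graphs (intersection graphs of finite families of real intervals). *)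

theory Defs
  imports
    "HOL-Analysis.Analysis"
    "HOL-Library.Extended_Nat"
    "Graph_Theory.Graph_Theory"
begin

text \<open>
  Finite simple graphs are the values of type \<^typ>\<open>'a pair_pre_digraph\<close> that satisfy
  \<^const>\<open>pair_graph\<close>: an edge \<open>uv\<close> is the pair of arcs \<open>(u, v)\<close>, \<open>(v, u)\<close>.
  The graph parameters below are defined for graphs on natural numbers, so that host graphs
  and guest graphs never run out of vertices.
\<close>

definition bipartite :: "'a pair_pre_digraph \<Rightarrow> bool" where
  "bipartite G \<longleftrightarrow>
     (\<exists>A B. pverts G = A \<union> B \<and> A \<inter> B = {} \<and> parcs G \<subseteq> A \<times> B \<union> B \<times> A)"


subsection \<open>Tree-width and simple tree-width\<close>

definition clique :: "'a pair_pre_digraph \<Rightarrow> nat \<Rightarrow> 'a set \<Rightarrow> bool" where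
  "clique G k S \<longleftrightarrow> S \<subseteq> pverts G \<and> finite S \<and> card S = k \<and>
     (\<forall>u\<in>S. \<forall>v\<in>S. u \<noteq> v \<longrightarrow> (u, v) \<in> parcs G)"

definition attach :: "'a pair_pre_digraph \<Rightarrow> 'a \<Rightarrow> 'a set \<Rightarrow> 'a pair_pre_digraph" where
  "attach G v S =
     \<lparr> pverts = insert v (pverts G), parcs = parcs G \<union> {v} \<times> S \<union> S \<times> {v} \<rparr>"

text \<open>The list records the cliques onto which vertices were added, latest first.\<close>

inductive k_tree_construction :: "nat \<Rightarrow> 'a pair_pre_digraph \<Rightarrow> 'a set list \<Rightarrow> bool"
  for k :: nat
where
  start: "complete_digraph (k + 1) (with_proj G) \<Longrightarrow> k_tree_construction k G []"
| add: "k_tree_construction k G Ss \<Longrightarrow> v \<notin> pverts G \<Longrightarrow> clique G k S \<Longrightarrow>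
    k_tree_construction k (attach G v S) (S # Ss)"

definition k_tree :: "nat \<Rightarrow> 'a pair_pre_digraph \<Rightarrow> bool" where
  "k_tree k G \<longleftrightarrow> (\<exists>Ss. k_tree_construction k G Ss)"

definition simple_k_tree :: "nat \<Rightarrow> 'a pair_pre_digraph \<Rightarrow> bool" where
  "simple_k_tree k G \<longleftrightarrow> (\<exists>Ss. k_tree_construction k G Ss \<and> distinct Ss)"

text \<open>Minima are infima in \<^typ>\<open>enat\<close>, hence attained unless there is no candidate at all.\<close>

definition tw :: "nat pair_pre_digraph \<Rightarrow> enat" where
  "tw G = (INF k \<in> {k. \<exists>H. k_tree k H \<and> subgraph (with_proj G) (with_proj H)}. enat k)"

definition stw :: "nat pair_pre_digraph \<Rightarrow> enat" where
  "stw G = (INF k \<in> {k. \<exists>H. simple_k_tree k H \<and> subgraph (with_proj G) (with_proj H)}. enat k)"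


subsection \<open>Folded covering numbers\<close>

definition graph_hom ::
  "('a \<Rightarrow> 'b) \<Rightarrow> 'a pair_pre_digraph \<Rightarrow> 'b pair_pre_digraph \<Rightarrow> bool" where
  "graph_hom \<phi> T G \<longleftrightarrow>
     \<phi> ` pverts T \<subseteq> pverts G \<and> map_prod \<phi> \<phi> ` parcs T \<subseteq> parcs G"

definition edge_surjective ::
  "('a \<Rightarrow> 'b) \<Rightarrow> 'a pair_pre_digraph \<Rightarrow> 'b pair_pre_digraph \<Rightarrow> bool" where
  "edge_surjective \<phi> T G \<longleftrightarrow> parcs G \<subseteq> map_prod \<phi> \<phi> ` parcs T"

definition folded_covers ::
  "(nat pair_pre_digraph \<Rightarrow> bool) \<Rightarrow> nat pair_pre_digraph \<Rightarrow>
   (nat pair_pre_digraph \<times> (nat \<Rightarrow> nat)) set" where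
  "folded_covers \<T> G =
     {(T, \<phi>). pair_graph T \<and> \<T> T \<and> graph_hom \<phi> T G \<and> edge_surjective \<phi> T G}"

definition folded_covering_number ::
  "(nat pair_pre_digraph \<Rightarrow> bool) \<Rightarrow> nat pair_pre_digraph \<Rightarrow> enat" where
  "folded_covering_number \<T> G =
     (INF (T, \<phi>) \<in> folded_covers \<T> G. SUP v \<in> pverts G. enat (card {x \<in> pverts T. \<phi> x = v}))"


subsection \<open>Caterpillar forests and interval graphs\<close>

text \<open>
  The library's \<^const>\<open>tree\<close> forbids all directed cycles, and therefore every edge of a
  symmetric digraph. In an undirected graph only cycles of length at least 3 count.
\<close>

definition undirected_tree :: "('a, 'b) pre_digraph \<Rightarrow> bool" where
  "undirected_tree G \<longleftrightarrow> graph G \<and> Digraph_Component.connected G \<and>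
     \<not> (\<exists>p. pre_digraph.cycle G p \<and> length p \<ge> 3)"

text \<open>The path without vertices is allowed: \<open>K\<^sub>2\<close> is a caterpillar without non-leaf vertices.\<close>

definition path_graph :: "('a, 'b) pre_digraph \<Rightarrow> bool" where
  "path_graph G \<longleftrightarrow>
     (\<exists>xs. distinct xs \<and> verts G = set xs \<and>
        arcs_ends G = set (vwalk_arcs xs) \<union> (set (vwalk_arcs xs))\<inverse>)"

definition caterpillar :: "('a, 'b) pre_digraph \<Rightarrow> bool" where
  "caterpillar G \<longleftrightarrow> undirected_tree G \<and>
     path_graph (G \<restriction> {v \<in> verts G. out_degree G v \<noteq> 1})"

text \<open>For symmetric digraphs, strong components are the connected components.\<close>

definition caterpillar_forest :: "'a pair_pre_digraph \<Rightarrow> bool" where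
  "caterpillar_forest G \<longleftrightarrow>
     pair_graph G \<and> (\<forall>C \<in> pre_digraph.sccs (with_proj G). caterpillar C)"

definition interval_graph :: "'a pair_pre_digraph \<Rightarrow> bool" where
  "interval_graph G \<longleftrightarrow> pair_graph G \<and>
     (\<exists>I :: 'a \<Rightarrow> real set.
        (\<forall>v \<in> pverts G. is_interval (I v) \<and> I v \<noteq> {}) \<and>
        parcs G = {(u, v). u \<in> pverts G \<and> v \<in> pverts G \<and> u \<noteq> v \<and> I u \<inter> I v \<noteq> {}})"

definition ca_f :: "nat pair_pre_digraph \<Rightarrow> enat" where
  "ca_f G = folded_covering_number caterpillar_forest G"

definition interval_number :: "nat pair_pre_digraph \<Rightarrow> enat" where
  "interval_number G = folded_covering_number interval_graph G"

end

theory Submission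
  imports Defs
begin

text \<open>
  The graph is \<open>K\<^bsub>k,n\<^esub>\<close> with \<open>n = 2 * k\<^sup>2 + 1\<close> and a pendant edge at each of the \<open>n\<close> vertices. In
  caterpillar forests, and in triangle-free interval graphs, every vertex has at most two neighbours
  of degree at least two. Hence if all vertices had at most \<open>k\<close> copies, then at one of the \<open>n\<close>
  vertices all copies adjacent to copies of the \<open>k\<close> vertices would be leaves; its \<open>k + 1\<close> edges
  would need \<open>k + 1\<close> copies. Conversely, \<open>k + 1\<close> copies suffice for a covering by stars, which is at
  the same time a caterpillar forest and an interval graph. The bound on \<open>stw\<close> holds for every
  graph, since a \<open>k\<close>-tree plus one extra vertex embeds into a simple \<open>(k+1)\<close>-tree.
\<close>

section \<open>Symmetric graphs\<close>

definition sym_graph :: "'a set \<Rightarrow> 'a rel \<Rightarrow> 'a pair_pre_digraph" where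
  "sym_graph V E = \<lparr> pverts = V, parcs = E \<union> E\<inverse> \<rparr>"

lemma pverts_sym_graph [simp]: "pverts (sym_graph V E) = V"
  by (simp add: sym_graph_def)

lemma parcs_sym_graph [simp]: "parcs (sym_graph V E) = E \<union> E\<inverse>"
  by (simp add: sym_graph_def)

text \<open>Replaces the locale by conditions on sets; the arc set is finite because it lies in a
  finite product.\<close>

lemma pair_graph_iff:
  "pair_graph G \<longleftrightarrow> finite (pverts G) \<and> parcs G \<subseteq> pverts G \<times> pverts G \<and>
     sym (parcs G) \<and> irrefl (parcs G)" (is "_ \<longleftrightarrow> ?R")
proof
  assume "pair_graph G"
  then interpret pair_graph G .
  have "irrefl (parcs G)"
    using pair_no_loops by (force simp: irrefl_def)
  then show ?R
    using pair_finite_verts pair_sym_arcs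
    by (auto simp: symmetric_def dest: in_arcsD1 in_arcsD2)
next
  assume R: ?R
  then have "finite (parcs G)"
    by (meson finite_SigmaI finite_subset)
  with R show "pair_graph G"
    by unfold_locales (auto simp: symmetric_def irrefl_def)
qed

lemma pair_graph_sym_graph:
  assumes "finite V" "E \<subseteq> V \<times> V" "irrefl E"
  shows "pair_graph (sym_graph V E)"
  using assms by (auto simp: pair_graph_iff sym_def irrefl_def)

lemma pair_graph_subgraphI:
  assumes "pair_graph G" "pair_graph H" "pverts G \<subseteq> pverts H" "parcs G \<subseteq> parcs H"
  shows "subgraph (with_proj G) (with_proj H)"
proof -
  interpret G: pair_graph G by fact
  interpret H: pair_graph H by fact
  show ?thesis
    using assms(3,4) G.pair_wf_digraph H.pair_wf_digraph
    by (simp add: subgraph_def compatible_def wf_digraph_wp_iff)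
qed


section \<open>Simple tree-width exceeds tree-width by at most one\<close>

lemma pair_graph_k_tree_construction:
  assumes "k_tree_construction k G Ss"
  shows "pair_graph G"
  using assms
proof induction
  case (start G)
  then show ?case by (auto simp: complete_digraph_def intro: pair_graphI_graph)
next
  case (add G Ss v S)
  then have "S \<subseteq> pverts G" by (simp add: clique_def)
  with add show ?case
    unfolding pair_graph_iff attach_def sym_def irrefl_def by auto
qed

lemma k_tree_construction_complete:
  assumes "finite K" "card K = k + 1"
  shows "k_tree_construction k (sym_graph K {(u, v). u \<in> K \<and> v \<in> K \<and> u \<noteq> v}) []"
proof (rule k_tree_construction.start)
  have "pair_graph (sym_graph K {(u, v). u \<in> K \<and> v \<in> K \<and> u \<noteq> v})"
    using assms by (intro pair_graph_sym_graph) (auto simp: irrefl_def)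
  then show "complete_digraph (k + 1) (with_proj (sym_graph K {(u, v). u \<in> K \<and> v \<in> K \<and> u \<noteq> v}))"
    using assms(2) by (auto simp: complete_digraph_def pair_graph.pair_graphD_graph)
qed

text \<open>Every new arc touches the fresh vertex \<open>v\<close>, and the neighbours of
  \<open>v\<close> are exactly those in \<open>S\<close>.\<close>

lemma clique_of_attachD:
  assumes "pair_graph G" "v \<notin> pverts G" "clique (attach G v S) k Q"
  shows "v \<notin> Q \<Longrightarrow> clique G k Q" and "v \<in> Q \<Longrightarrow> Q \<subseteq> insert v S"
  using assms by (auto simp: clique_def attach_def pair_graph_iff)

lemma clique_attachI:
  assumes "clique G m S" "R \<subseteq> insert v S" "card R = j"
  shows "clique (attach G v S) j R"
proof -
  have "(u, w) \<in> parcs (attach G v S)" if "u \<in> R" "w \<in> R" "u \<noteq> w" for u w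
  proof -
    from that assms(2) have "u \<in> insert v S" "w \<in> insert v S" by auto
    with that(3) assms(1) show ?thesis by (auto simp: clique_def attach_def)
  qed
  moreover have "R \<subseteq> pverts (attach G v S)" "finite R"
    using assms finite_subset[of R "insert v S"] by (auto simp: clique_def attach_def)
  ultimately show ?thesis
    using assms(3) by (simp add: clique_def)
qed

lemma clique_attach:
  assumes "clique G j R"
  shows "clique (attach G v S) j R"
  using assms by (auto simp: clique_def attach_def)

text \<open>
  Stacking onto a \<open>k\<close>-clique \<open>S\<close> is simulated by stacking onto a private \<open>(k+1)\<close>-clique
  \<open>f S \<supseteq> S\<close>. The new \<open>(k+1)\<close>-cliques suffice to give private ones to the
  \<open>k\<close>-cliques through the new vertex and to replace the one of \<open>S\<close> that was used up.
\<close>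

definition private_cliques ::
  "nat \<Rightarrow> 'a pair_pre_digraph \<Rightarrow> 'a pair_pre_digraph \<Rightarrow> 'a set list \<Rightarrow> ('a set \<Rightarrow> 'a set) \<Rightarrow> bool"
where
  "private_cliques k H H' Ss' f \<longleftrightarrow> inj_on f {S. clique H k S} \<and>
     (\<forall>S. clique H k S \<longrightarrow> S \<subseteq> f S \<and> clique H' (k + 1) (f S) \<and> f S \<notin> set Ss')"

lemma k_tree_into_simple_Suc_k_tree:
  assumes "k_tree_construction k H Ss" "x \<notin> pverts H"
  obtains H' Ss' f where "k_tree_construction (k + 1) H' Ss'" "distinct Ss'"
    "\<forall>S\<in>set Ss'. S \<subseteq> pverts H'" "pverts H' = insert x (pverts H)" "parcs H \<subseteq> parcs H'"
    "private_cliques k H H' Ss' f"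
  using assms
proof (induction arbitrary: thesis)
  case (start H)
  \<comment> \<open>The base host is complete on one more vertex \<open>x\<close>. Since
    \<open>x\<close> lies outside \<open>H\<close>, adding it to a \<open>k\<close>-clique gives a
    private \<open>(k + 1)\<close>-clique.\<close>
  define K where "K = insert x (pverts H)"
  define H' where "H' = sym_graph K {(u, v). u \<in> K \<and> v \<in> K \<and> u \<noteq> v}"
  have H: "pair_graph H" "card (pverts H) = k + 1"
    using start by (auto simp: complete_digraph_def intro: pair_graphI_graph)
  then have "finite (pverts H)"
    by (simp add: pair_graph_iff)
  with H(2) start.prems(2) have "finite K" "card K = (k + 1) + 1"
    by (auto simp: K_def)
  then have "k_tree_construction (k + 1) H' []"
    unfolding H'_def by (rule k_tree_construction_complete)
  moreover have "parcs H \<subseteq> parcs H'"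
    using H(1) by (auto simp: H'_def K_def pair_graph_iff irrefl_def)
  moreover have "clique H' (k + 1) (insert x S)" if "clique H k S" for S
    using that start.prems(2) by (auto simp: clique_def H'_def K_def card_insert_if)
  moreover have "inj_on (insert x) {S. clique H k S}"
  proof (rule inj_onI)
    fix S S' assume "S \<in> {S. clique H k S}" "S' \<in> {S. clique H k S}" "insert x S = insert x S'"
    moreover from this have "x \<notin> S" "x \<notin> S'"
      using start.prems(2) by (auto simp: clique_def)
    ultimately show "S = S'" by (simp add: insert_ident)
  qed
  ultimately show ?case
    by (intro start.prems(1)[of H' "[]" "insert x"]) (auto simp: H'_def K_def private_cliques_def)
next
  case (add H Ss v S)
  have x: "x \<notin> pverts H" "x \<noteq> v" using add.prems(2) by (auto simp: attach_def)
  obtain H' Ss' f where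
    H': "k_tree_construction (k + 1) H' Ss'" and dist: "distinct Ss'" and
    sub: "\<forall>Q\<in>set Ss'. Q \<subseteq> pverts H'" and
    verts: "pverts H' = insert x (pverts H)" and arcs: "parcs H \<subseteq> parcs H'" and
    priv: "private_cliques k H H' Ss' f"
    by (rule add.IH[OF _ x(1)])
  have f: "Q \<subseteq> f Q \<and> clique H' (k + 1) (f Q) \<and> f Q \<notin> set Ss'" if "clique H k Q" for Q
    using priv that by (simp add: private_cliques_def)
  have inj: "Q = Q'" if "clique H k Q" "clique H k Q'" "f Q = f Q'" for Q Q'
    using priv that by (simp add: private_cliques_def inj_on_def)
  have v: "v \<notin> pverts H" "v \<notin> pverts H'" using add.hyps verts x by auto
  have S: "clique H k S" by fact
  have G: "pair_graph H" using add.hyps(1) by (rule pair_graph_k_tree_construction)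
  let ?C = "f S"
  have "S \<subseteq> pverts H" "finite S" "card S = k"
    "?C \<subseteq> pverts H'" "finite ?C" "card ?C = k + 1" "S \<subseteq> ?C"
    using S f[OF S] by (auto simp: clique_def)
  note SC = this
  \<comment> \<open>The clique \<open>?C\<close>, onto which \<open>v\<close> will be stacked,
    exceeds \<open>S\<close> by a single vertex \<open>c\<close>.\<close>
  have "card (?C - S) = 1" using SC by (simp add: card_Diff_subset)
  then obtain c where c: "?C - S = {c}" by (auto simp: card_1_singleton_iff)
  have C: "?C = insert c S" "c \<notin> S" "c \<noteq> v" using c SC v by auto
  have cS: "clique H' (k + 1) (insert c S)" using f[OF S] C by simp
  \<comment> \<open>A \<open>k\<close>-clique through \<open>v\<close> lies in
    \<open>insert v S\<close> and avoids \<open>c\<close>, so adding \<open>c\<close> yields a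
    \<open>(k + 1)\<close>-clique. The spent clique of \<open>S\<close> is replaced by
    \<open>insert v S\<close>; all other cliques keep theirs.\<close>
  define g where "g Q = (if v \<in> Q then insert c Q else if Q = S then insert v S else f Q)" for Q
  let ?H = "attach H v S" and ?H' = "attach H' v ?C"
  have new: "clique ?H' (k + 1) R" if "R \<subseteq> insert v (insert c S)" "card R = k + 1" for R
    using clique_attachI[OF cS that] C(1) by simp
  have Q: "Q \<subseteq> insert v S" "finite Q" "card Q = k" "c \<notin> Q" if "clique ?H k Q" "v \<in> Q" for Q
    using that clique_of_attachD(2)[OF G v(1) that] C by (auto simp: clique_def)
  have g: "Q \<subseteq> g Q \<and> clique ?H' (k + 1) (g Q) \<and> g Q \<notin> set (?C # Ss')" if "clique ?H k Q" for Q
  proof -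
    consider "v \<in> Q" | "v \<notin> Q" "Q = S" | "v \<notin> Q" "Q \<noteq> S" by blast
    then show ?thesis
    proof cases
      case 1
      have "clique ?H' (k + 1) (insert c Q)"
        using Q[OF that 1] by (intro new) auto
      with 1 show ?thesis using sub v SC by (auto simp: g_def)
    next
      case 2
      have "clique ?H' (k + 1) (insert v S)"
        using 2 SC by (intro new) auto
      with 2 show ?thesis using sub v SC by (auto simp: g_def)
    next
      case 3
      have "clique H k Q" using clique_of_attachD(1)[OF G v(1) that 3(1)] .
      with 3 show ?thesis using f[of Q] inj[of Q S] S clique_attach[of H'] by (auto simp: g_def)
    qed
  qed
  \<comment> \<open>Values at cliques through \<open>v\<close> contain \<open>v\<close> and
    \<open>c\<close>, the value at \<open>S\<close> contains \<open>v\<close> but not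
    \<open>c\<close>, and kept values avoid \<open>v\<close>.\<close>
  have inj_g: "inj_on g {Q. clique ?H k Q}"
  proof (rule inj_onI, clarify)
    fix Q Q' assume *: "clique ?H k Q" "clique ?H k Q'" "g Q = g Q'"
    have vf: "v \<notin> f R" "clique H k R" if "clique ?H k R" "v \<notin> R" for R
      using clique_of_attachD(1)[OF G v(1) that] f[of R] v by (auto simp: clique_def)
    have cQ: "c \<notin> Q" if "v \<in> Q" using Q(4) * that by blast
    have cQ': "c \<notin> Q'" if "v \<in> Q'" using Q(4) * that by blast
    show "Q = Q'"
    proof (cases "v \<in> Q"; cases "v \<in> Q'")
      assume "v \<in> Q" "v \<in> Q'"
      then show ?thesis using *(3) cQ cQ' by (auto simp: g_def insert_ident)
    next
      assume "v \<in> Q" "v \<notin> Q'"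
      then show ?thesis using *(3) vf[OF *(2)] C by (auto simp: g_def split: if_splits)
    next
      assume "v \<notin> Q" "v \<in> Q'"
      then show ?thesis using *(3) vf[OF *(1)] C by (auto simp: g_def split: if_splits)
    next
      assume "v \<notin> Q" "v \<notin> Q'"
      then show ?thesis using *(3) vf[OF *(1)] vf[OF *(2)] inj[of Q Q']
        by (auto simp: g_def split: if_splits)
    qed
  qed
  have "k_tree_construction (k + 1) ?H' (?C # Ss')"
    using H' v f[OF S] by (intro k_tree_construction.add) auto
  moreover have "distinct (?C # Ss')" using dist f[OF S] by simp
  moreover have "\<forall>R\<in>set (?C # Ss'). R \<subseteq> pverts ?H'"
    "pverts ?H' = insert x (pverts ?H)" "parcs ?H \<subseteq> parcs ?H'"
    using verts arcs sub SC by (auto simp: attach_def)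
  moreover have "private_cliques k ?H ?H' (?C # Ss') g"
    using g inj_g by (simp add: private_cliques_def)
  ultimately show ?case by (intro add.prems(1))
qed

text \<open>An optimal host embeds into a simple \<open>(k + 1)\<close>-tree on one additional
  vertex, which is available because hosts are finite graphs on the naturals.\<close>

lemma stw_le_tw_plus_1:
  assumes "pair_graph G"
  shows "stw G \<le> tw G + 1"
proof -
  let ?A = "{k. \<exists>H. k_tree k H \<and> subgraph (with_proj G) (with_proj H)}"
  show ?thesis
  proof (cases "?A = {}")
    case True
    \<comment> \<open>The infimum over no candidates is infinite.\<close>
    show ?thesis unfolding tw_def True by (simp add: top_enat_def)
  next
    case False
    \<comment> \<open>By well-ordering, the infimum of a nonempty set is attained.\<close>
    then have "tw G \<in> enat ` ?A"
      unfolding tw_def by (metis (no_types, lifting) all_not_in_conv image_is_empty wellorder_InfI)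
    then obtain k H Ss where k: "tw G = enat k" and H: "k_tree_construction k H Ss"
      and GH: "subgraph (with_proj G) (with_proj H)"
      by (auto simp: k_tree_def)
    have "finite (pverts H)"
      using pair_graph_k_tree_construction[OF H] by (simp add: pair_graph_iff)
    then obtain x where "x \<notin> pverts H"
      using ex_new_if_finite infinite_UNIV_nat by blast
    then obtain H' Ss' f where
      H': "k_tree_construction (k + 1) H' Ss'" "distinct Ss'"
      and "\<forall>S\<in>set Ss'. S \<subseteq> pverts H'" "pverts H' = insert x (pverts H)" "parcs H \<subseteq> parcs H'"
      and "private_cliques k H H' Ss' f"
      by (rule k_tree_into_simple_Suc_k_tree[OF H])
    with GH assms have "subgraph (with_proj G) (with_proj H')"
      by (intro pair_graph_subgraphI pair_graph_k_tree_construction[OF H'(1)]) (auto simp: subgraph_def)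
    with H' have "stw G \<le> enat (k + 1)"
      unfolding stw_def by (intro INF_lower) (auto simp: simple_k_tree_def)
    then show ?thesis by (simp add: k one_enat_def)
  qed
qed


section \<open>Vertices with many branching neighbours\<close>

text \<open>In a simple graph these are the neighbours of degree at least two, expressed by a second
  neighbour \<open>z\<close> instead of a count.\<close>

definition branching_nbrs :: "'a pair_pre_digraph \<Rightarrow> 'a \<Rightarrow> 'a set" where
  "branching_nbrs T x = {y. (x, y) \<in> parcs T \<and> (\<exists>z. z \<noteq> x \<and> (y, z) \<in> parcs T)}"

lemma finite_branching_nbrs:
  assumes "pair_graph T"
  shows "finite (branching_nbrs T x)"
  using assms by (auto simp: pair_graph_iff branching_nbrs_def intro: finite_subset[of _ "pverts T"])

text \<open>
  Three neighbours of \<open>x\<close> in a triangle-free interval graph have disjoint intervals, all meeting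
  the interval of \<open>x\<close>, so the middle one is contained in the interval of \<open>x\<close>.
\<close>

lemma card_branching_nbrs_interval_graph:
  assumes T: "interval_graph T"
    and tri: "\<And>x y z. (x, y) \<in> parcs T \<Longrightarrow> (y, z) \<in> parcs T \<Longrightarrow> (x, z) \<notin> parcs T"
  shows "card (branching_nbrs T x) \<le> 2"
proof (rule ccontr)
  assume "\<not> ?thesis"
  then have "3 \<le> card (branching_nbrs T x)" by simp
  then obtain N where N: "N \<subseteq> branching_nbrs T x" "card N = 3"
    by (rule obtain_subset_with_card_n)
  from T obtain I :: "'a \<Rightarrow> real set" where
    I: "\<forall>v\<in>pverts T. is_interval (I v) \<and> I v \<noteq> {}" and
    parcs: "parcs T = {(u, v). u \<in> pverts T \<and> v \<in> pverts T \<and> u \<noteq> v \<and> I u \<inter> I v \<noteq> {}}"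
    unfolding interval_graph_def by (elim conjE exE) (rule that)
  have arcs: "(u, v) \<in> parcs T \<longleftrightarrow> u \<in> pverts T \<and> v \<in> pverts T \<and> u \<noteq> v \<and> I u \<inter> I v \<noteq> {}" for u v
    using parcs by simp
  have adj: "(x, y) \<in> parcs T" if "y \<in> N" for y
    using N(1) that by (auto simp: branching_nbrs_def)
  then have "\<forall>y\<in>N. \<exists>q. q \<in> I x \<and> q \<in> I y"
    using arcs by blast
  then obtain p where p: "p y \<in> I x" "p y \<in> I y" if "y \<in> N" for y
    by metis
  \<comment> \<open>Intersecting intervals of two different neighbours would close a triangle with
    \<open>x\<close>.\<close>
  have pt: "y = y'" if "y \<in> N" "y' \<in> N" "q \<in> I y" "q \<in> I y'" for y y' q
    using adj[OF that(1)] adj[OF that(2)] tri[of x y y'] that(3,4) arcs by blast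
  \<comment> \<open>The interval of \<open>b\<close> reaches neither \<open>p a\<close> nor
    \<open>p c\<close>. So a point \<open>q\<close> that it shares with the interval of a second
    neighbour \<open>z\<close> lies between them, hence in \<open>I x\<close>, and \<open>x\<close>,
    \<open>b\<close>, \<open>z\<close> form a triangle.\<close>
  have sorted: False if abc: "a \<in> N" "b \<in> N" "c \<in> N" "p a < p b" "p b < p c" for a b c
  proof -
    have "(x, b) \<in> parcs T" using adj abc(2) by blast
    obtain z where z: "z \<noteq> x" "(b, z) \<in> parcs T"
      using N(1) abc(2) by (auto simp: branching_nbrs_def)
    then obtain q where q: "q \<in> I b" "q \<in> I z" using arcs by blast
    have b: "is_interval (I b)" and x: "is_interval (I x)"
      using I arcs z(2) \<open>(x, b) \<in> parcs T\<close> by blast+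
    have "p a \<le> q"
    proof (rule ccontr)
      assume "\<not> p a \<le> q"
      then have "p a \<in> I b"
        using mem_is_interval_1_I[OF b q(1) p(2)[OF abc(2)]] abc(4) by simp
      then show False using pt[of a b "p a"] p abc by auto
    qed
    moreover have "q \<le> p c"
    proof (rule ccontr)
      assume "\<not> q \<le> p c"
      then have "p c \<in> I b"
        using mem_is_interval_1_I[OF b p(2)[OF abc(2)] q(1)] abc(5) by simp
      then show False using pt[of c b "p c"] p abc by auto
    qed
    ultimately have "q \<in> I x"
      using mem_is_interval_1_I[OF x p(1)[OF abc(1)] p(1)[OF abc(3)]] by simp
    then have "(x, z) \<in> parcs T"
      using q z \<open>(x, b) \<in> parcs T\<close> arcs by blast
    then show False using tri \<open>(x, b) \<in> parcs T\<close> z(2) by blast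
  qed
  have ne: "p a \<noteq> p b" if "a \<in> N" "b \<in> N" "a \<noteq> b" for a b
    using pt p that by metis
  from N(2) obtain a b c where "N = {a, b, c}" "a \<noteq> b" "a \<noteq> c" "b \<noteq> c"
    by (auto simp: card_3_iff)
  then show False
    using ne[of a b] ne[of a c] ne[of b c] sorted[of a b c] sorted[of a c b] sorted[of b a c]
      sorted[of b c a] sorted[of c a b] sorted[of c b a]
    by (simp add: neq_iff) linarith
qed

section \<open>Paths and caterpillar forests\<close>

lemma in_set_vwalk_arcsD: "(x, y) \<in> set (vwalk_arcs xs) \<Longrightarrow> x \<in> set xs \<and> y \<in> set (tl xs)"
  by (induction xs rule: vwalk_arcs.induct) auto

lemma vwalk_arcs_unique:
  assumes "distinct xs"
  shows "(x, y) \<in> set (vwalk_arcs xs) \<Longrightarrow> (x, z) \<in> set (vwalk_arcs xs) \<Longrightarrow> y = z"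
    and "(y, x) \<in> set (vwalk_arcs xs) \<Longrightarrow> (z, x) \<in> set (vwalk_arcs xs) \<Longrightarrow> y = z"
  using assms
  \<comment> \<open>In a distinct list the first vertex starts only the first arc, and the second
    vertex ends only that arc because all later targets lie further down the list.\<close>
  by (induction xs rule: vwalk_arcs.induct) (auto dest: in_set_vwalk_arcsD)

lemma card_le_1_if_unique:
  assumes "\<And>y z. y \<in> A \<Longrightarrow> z \<in> A \<Longrightarrow> y = z"
  shows "card A \<le> 1"
  \<comment> \<open>An infinite set would have cardinality 0.\<close>
  using assms by (cases "finite A") (auto simp: card_le_Suc0_iff_eq)

text \<open>A vertex has at most one successor and at most one predecessor in the list.\<close>

lemma card_nbrs_path_graph:
  assumes "path_graph G"
  shows "card {y. (x, y) \<in> arcs_ends G} \<le> 2"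
proof -
  from assms obtain xs where xs: "distinct xs"
    "arcs_ends G = set (vwalk_arcs xs) \<union> (set (vwalk_arcs xs))\<inverse>"
    by (auto simp: path_graph_def)
  have "{y. (x, y) \<in> arcs_ends G} =
      {y. (x, y) \<in> set (vwalk_arcs xs)} \<union> {y. (y, x) \<in> set (vwalk_arcs xs)}"
    using xs(2) by auto
  moreover have "card {y. (x, y) \<in> set (vwalk_arcs xs)} \<le> 1"
    "card {y. (y, x) \<in> set (vwalk_arcs xs)} \<le> 1"
    using vwalk_arcs_unique[OF xs(1)] by (blast intro: card_le_1_if_unique)+
  ultimately show ?thesis
    by (metis (no_types, lifting) add_mono card_Un_le one_add_one order_trans)
qed

lemma scc_closed:
  assumes "pair_graph T" "S \<in> pre_digraph.sccs_verts (with_proj T)" "u \<in> S" "(u, v) \<in> parcs T"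
  shows "v \<in> S"
proof -
  interpret pair_graph T by fact
  have "(v, u) \<in> parcs T" using assms(1,4) by (auto simp: pair_graph_iff dest: symD)
  then have "u \<rightarrow>\<^sup>*\<^bsub>with_proj T\<^esub> v" "v \<rightarrow>\<^sup>*\<^bsub>with_proj T\<^esub> u"
    using assms(4) by (auto intro: reachable_adjI)
  with assms(2,3) show ?thesis
    unfolding in_sccs_verts_conv_reachable by blast
qed

text \<open>A leaf has only one neighbour at all. Any other vertex lies on the spine of its
  component, and so do its branching neighbours, of which the path admits at most two.\<close>

lemma card_branching_nbrs_caterpillar_forest:
  assumes T: "caterpillar_forest T"
  shows "card (branching_nbrs T x) \<le> 2"
proof (cases "x \<in> pverts T")
  case False
  with T have "branching_nbrs T x = {}"
    by (auto simp: caterpillar_forest_def pair_graph_iff branching_nbrs_def)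
  then show ?thesis by simp
next
  case True
  have G: "pair_graph T" using T by (simp add: caterpillar_forest_def)
  then interpret pair_graph T .
  define S where "S = scc_of x"
  have S: "S \<in> sccs_verts" "x \<in> S"
    using True scc_of_in_sccs_verts in_scc_of_self by (auto simp: S_def)
  define C where "C = with_proj T \<restriction> S"
  define P where "P = C \<restriction> {v \<in> verts C. out_degree C v \<noteq> 1}"
  have "C \<in> sccs" using S(1) by (simp add: C_def in_sccs_verts_conv)
  with T have P: "path_graph P"
    by (simp add: caterpillar_forest_def caterpillar_def P_def)
  have closed: "v \<in> S" if "u \<in> S" "(u, v) \<in> parcs T" for u v
    using scc_closed[OF G S(1) that] .
  \<comment> \<open>Components are closed under adjacency, so degrees in \<open>C\<close> agree with
    degrees in \<open>T\<close>.\<close>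
  have out: "out_arcs C u = {u} \<times> {v. (u, v) \<in> parcs T}" if "u \<in> S" for u
    using closed[OF that] that by (auto simp: C_def out_arcs_def)
  have deg: "out_degree C u = card {v. (u, v) \<in> parcs T}" if "u \<in> S" for u
    by (simp add: out_degree_def out[OF that] card_cartesian_product)
  have fin: "finite {v. (u, v) \<in> parcs T}" for u
    using G by (auto simp: pair_graph_iff intro: finite_subset[of _ "pverts T"])
  show ?thesis
  proof (cases "out_degree C x = 1")
    case True
    have "card (branching_nbrs T x) \<le> card {v. (x, v) \<in> parcs T}"
      by (intro card_mono fin) (auto simp: branching_nbrs_def)
    with True show ?thesis by (simp add: deg S(2))
  next
    case False
    have "branching_nbrs T x \<subseteq> {y. (x, y) \<in> arcs_ends P}"
    proof
      fix y assume "y \<in> branching_nbrs T x"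
      then obtain z where y: "(x, y) \<in> parcs T" and z: "z \<noteq> x" "(y, z) \<in> parcs T"
        by (auto simp: branching_nbrs_def)
      have "y \<in> S" using closed S(2) y by blast
      have "(y, x) \<in> parcs T" using G y by (auto simp: pair_graph_iff dest: symD)
      then have "card {x, z} \<le> out_degree C y"
        unfolding deg[OF \<open>y \<in> S\<close>] using z(2) by (intro card_mono fin) auto
      then have "out_degree C y \<noteq> 1" using z(1) by simp
      with False y S(2) \<open>y \<in> S\<close> have "(x, y) \<in> arcs P"
        by (auto simp: P_def C_def)
      moreover have "tail P = fst" "head P = snd"
        by (simp_all add: P_def C_def)
      ultimately show "y \<in> {y. (x, y) \<in> arcs_ends P}"
        by (force simp: arcs_ends_conv)
    qed
    moreover have "finite {y. (x, y) \<in> arcs_ends P}"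
    proof (rule finite_subset)
      show "{y. (x, y) \<in> arcs_ends P} \<subseteq> {y. (x, y) \<in> parcs T}"
        by (auto simp: P_def C_def arcs_ends_conv)
    qed (rule fin)
    ultimately show ?thesis
      using card_nbrs_path_graph[OF P] card_mono order_trans by blast
  qed
qed

section \<open>Star forests\<close>

text \<open>The map \<open>r\<close> sends every vertex to the centre of its star.\<close>

definition star_forest :: "'a set \<Rightarrow> ('a \<Rightarrow> 'a) \<Rightarrow> 'a pair_pre_digraph" where
  "star_forest V r = sym_graph V {(v, r v) | v. v \<in> V \<and> r v \<noteq> v}"

text \<open>The centres are the fixed points of the idempotent map \<open>r\<close>; an isolated
  vertex is a centre without leaves.\<close>

locale star_centres =
  fixes V :: "'a set" and r :: "'a \<Rightarrow> 'a"
  assumes finite_V: "finite V" and r_in_V: "v \<in> V \<Longrightarrow> r v \<in> V" and r_r: "v \<in> V \<Longrightarrow> r (r v) = r v"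
begin

lemma pverts_star_forest [simp]: "pverts (star_forest V r) = V"
  by (simp add: star_forest_def)

lemma in_parcs_star_forest:
  "(u, v) \<in> parcs (star_forest V r) \<longleftrightarrow>
     u \<in> V \<and> v \<in> V \<and> u \<noteq> v \<and> (v = r u \<or> u = r v)"
  using r_in_V by (auto simp: star_forest_def)

lemma pair_graph_star_forest: "pair_graph (star_forest V r)"
  unfolding star_forest_def
  using finite_V r_in_V by (intro pair_graph_sym_graph) (auto simp: irrefl_def)

text \<open>The only neighbour of a vertex that is not a centre is its own centre.\<close>

lemma star_forest_no_path:
  assumes "(u, v) \<in> parcs (star_forest V r)" "(v, w) \<in> parcs (star_forest V r)" "u \<noteq> w"
  shows "r v = v"
  using assms r_r by (auto simp: in_parcs_star_forest)

lemma caterpillar_forest_star_forest: "caterpillar_forest (star_forest V r)"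
  unfolding caterpillar_forest_def
proof (intro conjI ballI pair_graph_star_forest)
  let ?T = "star_forest V r"
  interpret pair_graph ?T by (rule pair_graph_star_forest)
  fix C assume "C \<in> sccs"
  then obtain S where S: "S \<in> sccs_verts" and C: "C = with_proj ?T \<restriction> S"
    unfolding sccs_conv_sccs_verts by blast
  have closed: "v \<in> S" if "u \<in> S" "(u, v) \<in> parcs ?T" for u v
    using scc_closed[OF pair_graph_star_forest S that] .
  have "S \<subseteq> V" using sccs_verts_subsets[OF S] by simp
  have ind: "induced_subgraph C (with_proj ?T)" and sc: "strongly_connected C"
    using \<open>C \<in> sccs\<close> by auto
  have "graph C"
  proof -
    have "digraph C"
      using ind digraph_subgraph[of C] by blast
    moreover have "symmetric C"
      using induced_graph_imp_symmetric[OF sym_arcs ind] .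
    ultimately show ?thesis by (rule digraph.graphI)
  qed
  then interpret C: graph C .
  have "connected C"
    unfolding connected_def strongly_connected_def
    using sc C.reachable_mk_symmetricI by (simp add: strongly_connected_def)
  moreover have "\<not> (\<exists>p. C.cycle p \<and> length p \<ge> 3)"
  proof clarify
    fix p assume p: "C.cycle p" "length p \<ge> 3"
    then obtain e1 e2 e3 q where p_eq: "p = e1 # e2 # e3 # q"
      by (auto simp: numeral_3_eq_3 Suc_le_length_iff)
    have "compatible (with_proj ?T) C"
      using ind by blast
    then have CT: "C.cas = pcas" "C.awalk_verts = pawalk_verts"
      by (simp_all flip: compatible_cas compatible_awalk_verts)
    from p(1) obtain u where u: "C.awalk u p u" "distinct (tl (C.awalk_verts u p))"
      by (auto simp: C.cycle_def)
    have sub: "set p \<subseteq> parcs ?T"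
      using u(1) unfolding C.awalk_def by (auto simp: C)
    obtain v w t where e: "e1 = (u, v)" "e2 = (v, w)" "e3 = (w, t)"
      using u(1) by (cases e1; cases e2; cases e3) (auto simp: C.awalk_def CT p_eq)
    have q: "pcas t q u" using u(1) by (auto simp: C.awalk_def CT p_eq e)
    have "u \<in> set (pawalk_verts t q)" "t \<in> set (pawalk_verts t q)"
      using q by (induction q arbitrary: t) auto
    moreover have "v \<notin> insert w (set (pawalk_verts t q))" "w \<notin> set (pawalk_verts t q)"
      using u(2) by (auto simp: CT p_eq e)
    \<comment> \<open>\<open>t\<close> may equal \<open>u\<close>, but \<open>v\<close> and
      \<open>w\<close> each have two distinct neighbours on the cycle. Hence both are centres, and
      centres are never adjacent.\<close>
    ultimately have "u \<noteq> w" "v \<noteq> t" "v \<noteq> w" by auto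
    moreover have "(u, v) \<in> parcs ?T" "(v, w) \<in> parcs ?T" "(w, t) \<in> parcs ?T"
      using sub by (auto simp: p_eq e)
    ultimately have "r v = v" "r w = w"
      using star_forest_no_path by blast+
    with \<open>(v, w) \<in> parcs ?T\<close> show False
      by (auto simp: in_parcs_star_forest)
  qed
  ultimately have "undirected_tree C"
    using \<open>graph C\<close> by (simp add: undirected_tree_def)
  moreover have "path_graph (C \<restriction> {v \<in> verts C. out_degree C v \<noteq> 1})"
  proof -
    define Z where "Z = {v \<in> verts C. out_degree C v \<noteq> 1}"
    have centre: "r v = v" if "v \<in> Z" for v
    proof (rule ccontr)
      assume "r v \<noteq> v"
      have v: "v \<in> S" using that by (simp add: Z_def C)
      then have "out_arcs C v = {(v, r v)}"
        using \<open>r v \<noteq> v\<close> \<open>S \<subseteq> V\<close> closed[of v "r v"] r_in_V[of v] r_r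
        by (auto simp: out_arcs_def C in_parcs_star_forest)
      then show False using that by (simp add: Z_def out_degree_def)
    qed
    \<comment> \<open>Each component has only one centre, as \<open>r\<close> is constant along
      walks.\<close>
    have same: "r u = r v" if "u \<rightarrow>\<^sup>*\<^bsub>with_proj ?T\<^esub> v" for u v
      using that by (induction rule: reachable_induct) (auto simp: in_parcs_star_forest r_r)
    have "u = v" if "u \<in> Z" "v \<in> Z" for u v
      using same[of u v] S centre that by (auto simp: in_sccs_verts_conv_reachable Z_def C)
    \<comment> \<open>The spine is a single centre, or empty when the component is a single edge,
      whose two ends are both leaves.\<close>
    then obtain xs where xs: "distinct xs" "Z = set xs" "vwalk_arcs xs = []"
      by (metis distinct.simps(1) distinct_singleton empty_set is_singletonI' is_singleton_def
          list.simps(15) vwalk_arcs.simps(1,2))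
    have "arcs_ends (C \<restriction> Z) = {}"
    proof -
      have "False" if "u \<in> Z" "v \<in> Z" "(u, v) \<in> parcs ?T" for u v
        using centre that by (auto simp: in_parcs_star_forest)
      then show ?thesis by (auto simp: arcs_ends_conv C)
    qed
    with xs show ?thesis
      unfolding path_graph_def Z_def[symmetric] by (intro exI[of _ xs]) simp
  qed
  ultimately show "caterpillar C" by (simp add: caterpillar_def)
qed

end

text \<open>A centre \<open>v\<close> gets the half-open unit interval from \<open>v\<close> to
  \<open>v + 1\<close>, and its leaves get distinct interior points of it.\<close>

lemma interval_graph_star_forest:
  fixes V :: "nat set"
  assumes "star_centres V r"
  shows "interval_graph (star_forest V r)"
proof -
  interpret star_centres V r by fact
  \<comment> \<open>The shift by 2 keeps the offset below 1 even at \<open>v = 0\<close>.\<close>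
  define \<epsilon> :: "nat \<Rightarrow> real" where "\<epsilon> v = 1 / (real v + 2)" for v
  have \<epsilon>: "0 < \<epsilon> v" "\<epsilon> v < 1" "\<epsilon> u = \<epsilon> v \<longleftrightarrow> u = v" for u v
    by (auto simp: \<epsilon>_def field_simps)
  \<comment> \<open>Uniqueness of integer and fractional parts.\<close>
  have sep: "real m + a = real n + b \<longleftrightarrow> m = n \<and> a = b"
    if "0 \<le> a" "a < 1" "0 \<le> b" "b < 1" for m n a b
  proof
    assume *: "real m + a = real n + b"
    then have "\<bar>real m - real n\<bar> < 1" using that by linarith
    then have "m = n" by linarith
    with * show "m = n \<and> a = b" by simp
  qed simp
  define I where "I v = (if r v = v then {real v..<real v + 1} else {real (r v) + \<epsilon> v})" for v
  have mem: "s \<in> I v \<longleftrightarrow> (if r v = v then \<exists>a. 0 \<le> a \<and> a < 1 \<and> s = real v + a else s = real (r v) + \<epsilon> v)" for s v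
    by (auto simp: I_def intro: exI[of _ "s - real v"])
  have meet: "I u \<inter> I v \<noteq> {} \<longleftrightarrow> v = r u \<or> u = r v" if "u \<in> V" "v \<in> V" "u \<noteq> v" for u v
  proof -
    have "I u \<inter> I v \<noteq> {} \<longleftrightarrow> (\<exists>s. s \<in> I u \<and> s \<in> I v)" by auto
    also have "\<dots> \<longleftrightarrow> r u = r v \<and> (r u = u \<or> r v = v)"
    proof
      assume "\<exists>s. s \<in> I u \<and> s \<in> I v"
      then show "r u = r v \<and> (r u = u \<or> r v = v)"
        using \<epsilon> that(3) by (auto simp: mem sep less_imp_le split: if_splits)
    next
      assume *: "r u = r v \<and> (r u = u \<or> r v = v)"
      with that(3) consider "r u = u" "r v = u" "r v \<noteq> v" | "r v = v" "r u = v" "r u \<noteq> u" by auto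
      then show "\<exists>s. s \<in> I u \<and> s \<in> I v"
        by cases (auto simp: I_def \<epsilon> less_imp_le)
    qed
    also have "\<dots> \<longleftrightarrow> v = r u \<or> u = r v"
      using that r_r by metis
    finally show ?thesis .
  qed
  have "\<forall>v\<in>V. is_interval (I v) \<and> I v \<noteq> {}"
    by (auto simp: I_def is_interval_1)
  moreover have "(u, v) \<in> parcs (star_forest V r) \<longleftrightarrow>
      u \<in> V \<and> v \<in> V \<and> u \<noteq> v \<and> I u \<inter> I v \<noteq> {}" for u v
    unfolding in_parcs_star_forest using meet[of u v] by blast
  then have "parcs (star_forest V r) = {(u, v). u \<in> V \<and> v \<in> V \<and> u \<noteq> v \<and> I u \<inter> I v \<noteq> {}}"
    by auto
  ultimately show ?thesis
    unfolding interval_graph_def using pair_graph_star_forest by auto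
qed


section \<open>A complete bipartite graph with pendant edges\<close>

text \<open>
  The vertices \<open>i < k\<close> are joined to all vertices \<open>k + j\<close> with \<open>j < n\<close>, and \<open>k + n + j\<close> is a leaf
  at \<open>k + j\<close>.
\<close>

definition hairy_bipartite :: "nat \<Rightarrow> nat \<Rightarrow> nat pair_pre_digraph" where
  "hairy_bipartite k n =
     sym_graph {..<k + 2 * n} ({..<k} \<times> {k..<k + n} \<union> {(v, v + n) | v. v \<in> {k..<k + n}})"

lemma pair_graph_hairy_bipartite: "pair_graph (hairy_bipartite k n)"
  unfolding hairy_bipartite_def by (intro pair_graph_sym_graph) (auto simp: irrefl_def)

lemma bipartite_hairy_bipartite: "bipartite (hairy_bipartite k n)"
  unfolding bipartite_def
  by (intro exI[of _ "{..<k} \<union> {k + n..<k + 2 * n}"] exI[of _ "{k..<k + n}"])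
    (auto simp: hairy_bipartite_def)

text \<open>A triangle would be mapped to a closed walk of length three, which cannot alternate
  between two sides.\<close>

lemma bipartite_hom_triangle_free:
  assumes "bipartite G" "graph_hom \<phi> T G" "(x, y) \<in> parcs T" "(y, z) \<in> parcs T"
  shows "(x, z) \<notin> parcs T"
proof
  assume "(x, z) \<in> parcs T"
  with assms(2-4) have "(\<phi> x, \<phi> y) \<in> parcs G" "(\<phi> y, \<phi> z) \<in> parcs G" "(\<phi> x, \<phi> z) \<in> parcs G"
    by (auto simp: graph_hom_def)
  with assms(1) show False unfolding bipartite_def by blast
qed

section \<open>Tree-width of the graph\<close>

lemma k_tree_complete_part:
  assumes "m \<ge> 1"
  shows "\<exists>H Ss. k_tree_construction k H Ss \<and> pverts H = {..<k + m} \<and>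
    (\<forall>u<k. \<forall>v<k + m. u \<noteq> v \<longrightarrow> (u, v) \<in> parcs H \<and> (v, u) \<in> parcs H)"
  using assms
proof (induction m rule: nat_induct_at_least)
  case base
  show ?case
    by (intro exI conjI, rule k_tree_construction_complete[of "{..<k + 1}"]) auto
next
  case (Suc m)
  from Suc.IH obtain H Ss where H: "k_tree_construction k H Ss" "pverts H = {..<k + m}"
    "\<forall>u<k. \<forall>v<k + m. u \<noteq> v \<longrightarrow> (u, v) \<in> parcs H \<and> (v, u) \<in> parcs H"
    by (elim exE conjE) (rule that)
  \<comment> \<open>All vertices after the initial clique are stacked onto the same clique
    \<open>{..<k}\<close>.\<close>
  have "k_tree_construction k (attach H (k + m) {..<k}) ({..<k} # Ss)"
    using H by (intro k_tree_construction.add) (auto simp: clique_def)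
  moreover have "pverts (attach H (k + m) {..<k}) = {..<k + Suc m}"
    by (simp add: H(2) attach_def lessThan_Suc)
  moreover have "(u, v) \<in> parcs (attach H (k + m) {..<k}) \<and> (v, u) \<in> parcs (attach H (k + m) {..<k})"
    if "u < k" "v < k + Suc m" "u \<noteq> v" for u v
  proof (cases "v = k + m")
    case True
    then show ?thesis using that(1) by (simp add: attach_def)
  next
    case False
    then have "v < k + m" using that(2) by simp
    then show ?thesis using that(1,3) H(3) by (simp add: attach_def)
  qed
  ultimately show ?case by blast
qed

lemma k_tree_hairy_part:
  assumes "k \<ge> 1" "n \<ge> 1" "m \<le> n"
  shows "\<exists>H Ss. k_tree_construction k H Ss \<and> pverts H = {..<k + n + m} \<and>
    (\<forall>u<k. \<forall>v<k + n. u \<noteq> v \<longrightarrow> (u, v) \<in> parcs H \<and> (v, u) \<in> parcs H) \<and>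
    (\<forall>j<m. (k + j, k + j + n) \<in> parcs H \<and> (k + j + n, k + j) \<in> parcs H)"
  using assms(3)
proof (induction m)
  case 0
  show ?case using k_tree_complete_part[OF assms(2), of k] by simp
next
  case (Suc m)
  then obtain H Ss where H: "k_tree_construction k H Ss" "pverts H = {..<k + n + m}"
    "\<forall>u<k. \<forall>v<k + n. u \<noteq> v \<longrightarrow> (u, v) \<in> parcs H \<and> (v, u) \<in> parcs H"
    "\<forall>j<m. (k + j, k + j + n) \<in> parcs H \<and> (k + j + n, k + j) \<in> parcs H"
    by auto
  define S where "S = insert (k + m) {1..<k}"
  let ?H = "attach H (k + n + m) S"
  have "clique H k S"
    using H Suc.prems assms(1) by (auto simp: S_def clique_def)
  then have "k_tree_construction k ?H (S # Ss)"
    using H by (intro k_tree_construction.add) auto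
  moreover have "pverts ?H = {..<k + n + Suc m}"
    by (simp add: H(2) attach_def lessThan_Suc)
  moreover have "\<forall>u<k. \<forall>v<k + n. u \<noteq> v \<longrightarrow> (u, v) \<in> parcs ?H \<and> (v, u) \<in> parcs ?H"
    using H(3) by (simp add: attach_def)
  moreover have "\<forall>j<Suc m. (k + j, k + j + n) \<in> parcs ?H \<and> (k + j + n, k + j) \<in> parcs ?H"
    using H(4) by (auto simp: attach_def S_def less_Suc_eq)
  ultimately show ?case by blast
qed

lemma tw_hairy_bipartite_le:
  assumes "k \<ge> 1" "n \<ge> 1"
  shows "tw (hairy_bipartite k n) \<le> enat k"
proof -
  obtain H Ss where H: "k_tree_construction k H Ss" "pverts H = {..<k + n + n}"
    "\<forall>u<k. \<forall>v<k + n. u \<noteq> v \<longrightarrow> (u, v) \<in> parcs H \<and> (v, u) \<in> parcs H"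
    "\<forall>j<n. (k + j, k + j + n) \<in> parcs H \<and> (k + j + n, k + j) \<in> parcs H"
    using k_tree_hairy_part[OF assms order_refl] by blast
  have leaf: "(v, v + n) \<in> parcs H \<and> (v + n, v) \<in> parcs H" if "k \<le> v" "v < k + n" for v
    using H(4)[rule_format, of "v - k"] that by simp
  have "subgraph (with_proj (hairy_bipartite k n)) (with_proj H)"
  proof (rule pair_graph_subgraphI)
    show "pverts (hairy_bipartite k n) \<subseteq> pverts H"
      using H(2) by (auto simp: hairy_bipartite_def)
    show "parcs (hairy_bipartite k n) \<subseteq> parcs H"
      using H(3) leaf by (auto simp: hairy_bipartite_def)
  qed (use H(1) in \<open>auto intro: pair_graph_hairy_bipartite pair_graph_k_tree_construction\<close>)
  then show ?thesis
    unfolding tw_def k_tree_def using H(1) by (intro INF_lower) auto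
qed

section \<open>Lower bound on the folded covering numbers\<close>

text \<open>
  If every vertex has at most \<open>k\<close> copies, there are at most \<open>k\<^sup>2\<close> copies of vertices \<open>i < k\<close>, with at
  most \<open>2 * k\<^sup>2\<close> branching neighbours. So for some \<open>j\<close> no copy of \<open>k + j\<close> is such a neighbour, hence
  the \<open>k + 1\<close> edges at \<open>k + j\<close> are covered by edges at distinct copies.
\<close>

lemma hairy_bipartite_many_copies:
  assumes "k \<ge> 1" "n > 2 * k\<^sup>2"
    and T: "pair_graph T" and es: "edge_surjective \<phi> T (hairy_bipartite k n)"
    and branch: "\<And>x. card (branching_nbrs T x) \<le> 2"
  shows "\<exists>v\<in>pverts (hairy_bipartite k n). k + 1 \<le> card {x \<in> pverts T. \<phi> x = v}"
proof (rule ccontr)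
  assume "\<not> ?thesis"
  then have few: "card {x \<in> pverts T. \<phi> x = v} \<le> k" if "v < k + 2 * n" for v
    using that by (force simp: hairy_bipartite_def)
  have fin: "finite (pverts T)" using T by (simp add: pair_graph_iff)
  define X where "X = (\<Union>i<k. {x \<in> pverts T. \<phi> x = i})"
  define B where "B = (\<Union>x\<in>X. branching_nbrs T x)"
  have finX: "finite X" using fin by (simp add: X_def)
  have "card X \<le> (\<Sum>i<k. card {x \<in> pverts T. \<phi> x = i})"
    unfolding X_def by (intro card_UN_le) simp
  also have "\<dots> \<le> (\<Sum>i<k. k)"
    by (intro sum_mono few) simp
  finally have cardX: "card X \<le> k\<^sup>2" by (simp add: power2_eq_square)
  have "card B \<le> (\<Sum>x\<in>X. card (branching_nbrs T x))"
    unfolding B_def by (rule card_UN_le[OF finX])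
  also have "\<dots> \<le> (\<Sum>x\<in>X. 2)"
    by (intro sum_mono branch)
  finally have "card B \<le> 2 * k\<^sup>2" using cardX by simp
  moreover have "finite B"
    unfolding B_def using finX finite_branching_nbrs[OF T] by blast
  ultimately have "card (\<phi> ` B) < card {k..<k + n}"
    using assms(2) card_image_le[of B \<phi>] by simp
  then have "\<not> {k..<k + n} \<subseteq> \<phi> ` B"
    using \<open>finite B\<close> card_mono[of "\<phi> ` B" "{k..<k + n}"] by auto
  then obtain b where b: "k \<le> b" "b < k + n" "b \<notin> \<phi> ` B"
    by (meson atLeastLessThan_iff subsetI)
  \<comment> \<open>For \<open>i \<le> k\<close> these are the \<open>k + 1\<close> neighbours of
    \<open>b\<close>; index \<open>k\<close> stands for the pendant one.\<close>
  define w where "w i = (if i < k then i else b + n)" for i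
  have "(w i, b) \<in> parcs (hairy_bipartite k n)" for i
    using b(1,2) by (auto simp: w_def hairy_bipartite_def)
  then have cov: "(w i, b) \<in> map_prod \<phi> \<phi> ` parcs T" for i
    using es unfolding edge_surjective_def by blast
  have "\<forall>i. \<exists>e. e \<in> parcs T \<and> \<phi> (fst e) = w i \<and> \<phi> (snd e) = b"
  proof
    fix i
    obtain e where "(w i, b) = map_prod \<phi> \<phi> e" "e \<in> parcs T"
      using cov[of i] by (rule imageE)
    then show "\<exists>e. e \<in> parcs T \<and> \<phi> (fst e) = w i \<and> \<phi> (snd e) = b"
      by (intro exI[of _ e]) (cases e, simp)
  qed
  from choice[OF this] obtain e where e: "\<forall>i. e i \<in> parcs T \<and> \<phi> (fst (e i)) = w i \<and> \<phi> (snd (e i)) = b"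
    by (elim exE) (rule that)
  define g where "g i = fst (e i)" for i
  define f where "f i = snd (e i)" for i
  have gf: "(g i, f i) \<in> parcs T" "\<phi> (g i) = w i" "\<phi> (f i) = b" for i
    using e by (simp_all add: g_def f_def)
  \<comment> \<open>A shared copy of \<open>b\<close> would have the two neighbours
    \<open>g i\<close> and \<open>g j\<close>. As \<open>i < j \<le> k\<close> forces
    \<open>i < k\<close>, the vertex \<open>g i\<close> is in \<open>X\<close>, so that copy would
    be in \<open>B\<close>.\<close>
  have "f i \<noteq> f j" if "i < j" "j \<le> k" for i j
  proof
    assume eq: "f i = f j"
    have "w i \<noteq> w j" using that b(1) by (auto simp: w_def)
    then have "g j \<noteq> g i" using gf(2) by metis
    moreover have "(f i, g j) \<in> parcs T"
      using gf(1)[of j] T eq by (auto simp: pair_graph_iff dest: symD)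
    ultimately have "f i \<in> branching_nbrs T (g i)"
      using gf(1) by (auto simp: branching_nbrs_def)
    moreover have "g i \<in> X"
      using gf(1,2)[of i] that T by (auto simp: X_def w_def pair_graph_iff)
    ultimately have "b \<in> \<phi> ` B" using gf(3) by (force simp: B_def)
    with b(3) show False ..
  qed
  then have "inj_on f {..k}"
    by (intro linorder_inj_onI) auto
  then have "k + 1 \<le> card (f ` {..k})" by (simp add: card_image)
  also have "\<dots> \<le> card {x \<in> pverts T. \<phi> x = b}"
    using gf T fin by (intro card_mono) (auto simp: pair_graph_iff)
  also have "\<dots> \<le> k" using b by (intro few) simp
  finally show False by simp
qed

text \<open>The homomorphism is available in \<open>branch\<close> because interval graphs need the
  triangle-freeness that it provides.\<close>

lemma folded_covering_number_hairy_bipartite_ge: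
  assumes "k \<ge> 1" "n > 2 * k\<^sup>2"
    and branch: "\<And>T \<phi> x. pair_graph T \<Longrightarrow> \<T> T \<Longrightarrow> graph_hom \<phi> T (hairy_bipartite k n) \<Longrightarrow>
      card (branching_nbrs T x) \<le> 2"
  shows "enat k + 1 \<le> folded_covering_number \<T> (hairy_bipartite k n)"
  unfolding folded_covering_number_def
proof (rule INF_greatest, clarify)
  fix T \<phi> assume "(T, \<phi>) \<in> folded_covers \<T> (hairy_bipartite k n)"
  then have T: "pair_graph T" "\<T> T" "graph_hom \<phi> T (hairy_bipartite k n)"
    "edge_surjective \<phi> T (hairy_bipartite k n)"
    by (auto simp: folded_covers_def)
  from hairy_bipartite_many_copies[OF assms(1,2) T(1,4) branch[OF T(1-3)]]
  obtain v where v: "v \<in> pverts (hairy_bipartite k n)" "k + 1 \<le> card {x \<in> pverts T. \<phi> x = v}"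
    by blast
  from v(2) have "enat k + 1 \<le> enat (card {x \<in> pverts T. \<phi> x = v})"
    by (simp add: one_enat_def)
  also have "\<dots> \<le> (SUP v\<in>pverts (hairy_bipartite k n). enat (card {x \<in> pverts T. \<phi> x = v}))"
    using v(1) by (intro SUP_upper)
  finally show "enat k + 1 \<le> (SUP v\<in>pverts (hairy_bipartite k n). enat (card {x \<in> pverts T. \<phi> x = v}))" .
qed

section \<open>Upper bound on the folded covering numbers\<close>

text \<open>
  Copy \<open>m < k\<close> of a vertex \<open>v = k + j\<close> is a leaf of the star centred at the only copy of \<open>m\<close>, and
  copy \<open>k\<close> forms a single edge with the only copy of the pendant vertex \<open>v + n\<close>.
\<close>

lemma folded_covering_number_hairy_bipartite_le:
  assumes star: "\<And>V r. star_centres V r \<Longrightarrow> \<T> (star_forest V r)"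
  shows "folded_covering_number \<T> (hairy_bipartite k n) \<le> enat k + 1"
proof -
  define mid where "mid v \<longleftrightarrow> k \<le> v \<and> v < k + n" for v
  \<comment> \<open>Copy \<open>m\<close> of \<open>v\<close> is encoded as one natural number,
    since covering graphs live on the naturals. Only the vertices \<open>k + j\<close> get more than
    one copy.\<close>
  define V where "V = prod_encode ` {(v, m). v < k + 2 * n \<and> m \<le> (if mid v then k else 0)}"
  define r where "r p = (case prod_decode p of (v, m) \<Rightarrow>
    if mid v then prod_encode (if m < k then m else v + n, 0) else p)" for p
  define \<phi> where "\<phi> = fst \<circ> prod_decode"
  let ?T = "star_forest V r" and ?G = "hairy_bipartite k n"
  have in_V: "prod_encode (v, m) \<in> V \<longleftrightarrow> v < k + 2 * n \<and> m \<le> (if mid v then k else 0)" for v m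
    by (auto simp: V_def)
  have V_cases: "\<exists>v m. p = prod_encode (v, m) \<and> v < k + 2 * n \<and> m \<le> (if mid v then k else 0)"
    if "p \<in> V" for p
    using that unfolding V_def by blast
  have r: "r (prod_encode (v, m)) =
      (if mid v then prod_encode (if m < k then m else v + n, 0) else prod_encode (v, m))" for v m
    by (simp add: r_def)
  have \<phi>: "\<phi> (prod_encode (v, m)) = v" for v m
    by (simp add: \<phi>_def)
  have "finite {(v, m). v < k + 2 * n \<and> m \<le> (if mid v then k else 0)}"
    by (rule finite_subset[of _ "{..<k + 2 * n} \<times> {..k}"]) (auto split: if_splits)
  then have "finite V" by (simp add: V_def)
  \<comment> \<open>The stars of the copies of middle vertices are centred outside the middle part,
    where \<open>r\<close> is the identity; hence \<open>r\<close> is idempotent.\<close>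
  have not_mid: "\<not> mid m" if "m < k" for m using that by (simp add: mid_def)
  have not_mid': "\<not> mid (v + n)" if "mid v" for v using that by (simp add: mid_def)
  interpret star_centres V r
  proof
    fix p assume "p \<in> V"
    then obtain v m where p: "p = prod_encode (v, m)" "v < k + 2 * n" "m \<le> (if mid v then k else 0)"
      using V_cases by blast
    have "v + n < k + 2 * n" if "mid v" using that by (simp add: mid_def)
    then show "r p \<in> V" using p by (auto simp: r in_V)
    show "r (r p) = r p" using not_mid not_mid' by (auto simp: p(1) r)
  qed fact
  have edge: "i < k \<Longrightarrow> (v, i) \<in> parcs ?G \<and> (i, v) \<in> parcs ?G"
    "(v, v + n) \<in> parcs ?G \<and> (v + n, v) \<in> parcs ?G" if "mid v" for v i
    using that by (auto simp: hairy_bipartite_def mid_def)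
  have arc: "(\<phi> p, \<phi> (r p)) \<in> parcs ?G \<and> (\<phi> (r p), \<phi> p) \<in> parcs ?G" if "p \<in> V" "r p \<noteq> p" for p
  proof -
    obtain v m where p: "p = prod_encode (v, m)" using V_cases[OF \<open>p \<in> V\<close>] by blast
    with \<open>r p \<noteq> p\<close> have "mid v" by (simp add: r split: if_splits)
    with edge show ?thesis by (simp add: p r \<phi>)
  qed
  have "\<phi> ` V \<subseteq> pverts ?G"
    by (auto simp: V_def \<phi> hairy_bipartite_def)
  moreover have "(\<phi> p, \<phi> q) \<in> parcs ?G" if "(p, q) \<in> parcs ?T" for p q
    using that arc[of p] arc[of q] by (auto simp: in_parcs_star_forest)
  ultimately have "graph_hom \<phi> ?T ?G"
    by (auto simp: graph_hom_def)
  moreover have "edge_surjective \<phi> ?T ?G"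
  proof -
    have cover: "(\<phi> p, \<phi> (r p)) \<in> map_prod \<phi> \<phi> ` parcs ?T \<and> (\<phi> (r p), \<phi> p) \<in> map_prod \<phi> \<phi> ` parcs ?T"
      if "p \<in> V" "r p \<noteq> p" for p
    proof -
      have "(p, r p) \<in> parcs ?T" "(r p, p) \<in> parcs ?T"
        using that r_in_V[of p] by (auto simp: in_parcs_star_forest)
      then show ?thesis by (metis image_eqI map_prod_simp)
    qed
    have "(i, v) \<in> map_prod \<phi> \<phi> ` parcs ?T \<and> (v, i) \<in> map_prod \<phi> \<phi> ` parcs ?T"
      if "i < k" "mid v" for i v
    proof -
      have "v < k + 2 * n" "i \<noteq> v" using that by (auto simp: mid_def)
      then show ?thesis
        using cover[of "prod_encode (v, i)"] that by (simp add: in_V r \<phi>)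
    qed
    moreover have "(v + n, v) \<in> map_prod \<phi> \<phi> ` parcs ?T \<and> (v, v + n) \<in> map_prod \<phi> \<phi> ` parcs ?T"
      if "mid v" for v
    proof -
      have "v < k + 2 * n" "n \<noteq> 0" using that by (auto simp: mid_def)
      then show ?thesis
        using cover[of "prod_encode (v, k)"] that by (simp add: in_V r \<phi>)
    qed
    ultimately show ?thesis
      unfolding edge_surjective_def hairy_bipartite_def mid_def by auto
  qed
  ultimately have "(?T, \<phi>) \<in> folded_covers \<T> ?G"
    using pair_graph_star_forest star[OF star_centres_axioms] by (simp add: folded_covers_def)
  then have "folded_covering_number \<T> ?G \<le> (SUP v\<in>pverts ?G. enat (card {x \<in> pverts ?T. \<phi> x = v}))"
    unfolding folded_covering_number_def by (rule INF_lower2) simp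
  also have "\<dots> \<le> enat k + 1"
  proof (rule SUP_least)
    fix v
    have "{x \<in> V. \<phi> x = v} \<subseteq> (\<lambda>m. prod_encode (v, m)) ` {..k}"
      by (auto simp: V_def \<phi> split: if_splits)
    from surj_card_le[OF _ this] have "card {x \<in> V. \<phi> x = v} \<le> k + 1" by simp
    then show "enat (card {x \<in> pverts ?T. \<phi> x = v}) \<le> enat k + 1"
      by (simp add: one_enat_def)
  qed
  finally show ?thesis .
qed

theorem theorem15:
  fixes k :: nat
  assumes "k \<ge> 1"
  shows "\<exists>G :: nat pair_pre_digraph. pair_graph G \<and> bipartite G \<and>
    stw G \<le> tw G + 1 \<and> tw G + 1 \<le> enat k + 1 \<and>
    enat k + 1 \<le> ca_f G \<and> ca_f G = interval_number G"
proof -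
  define n where "n = 2 * k\<^sup>2 + 1"
  let ?G = "hairy_bipartite k n"
  have n: "n > 2 * k\<^sup>2" "n \<ge> 1" by (simp_all add: n_def)
  \<comment> \<open>Both covering numbers are computed exactly, which yields their equality.\<close>
  have "ca_f ?G = enat k + 1"
    unfolding ca_f_def
  proof (rule antisym)
    show "folded_covering_number caterpillar_forest ?G \<le> enat k + 1"
      by (intro folded_covering_number_hairy_bipartite_le star_centres.caterpillar_forest_star_forest)
    show "enat k + 1 \<le> folded_covering_number caterpillar_forest ?G"
      using assms n(1)
      by (rule folded_covering_number_hairy_bipartite_ge) (rule card_branching_nbrs_caterpillar_forest)
  qed
  moreover have "interval_number ?G = enat k + 1"
    unfolding interval_number_def
  proof (rule antisym)
    show "folded_covering_number interval_graph ?G \<le> enat k + 1"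
      by (intro folded_covering_number_hairy_bipartite_le interval_graph_star_forest)
    show "enat k + 1 \<le> folded_covering_number interval_graph ?G"
      using assms n(1)
    proof (rule folded_covering_number_hairy_bipartite_ge)
      fix T \<phi> x assume T: "interval_graph T" "graph_hom \<phi> T ?G"
      then show "card (branching_nbrs T x) \<le> 2"
        using bipartite_hom_triangle_free[OF bipartite_hairy_bipartite T(2)]
        by (intro card_branching_nbrs_interval_graph)
    qed
  qed
  ultimately show ?thesis
    using pair_graph_hairy_bipartite bipartite_hairy_bipartite
      stw_le_tw_plus_1[OF pair_graph_hairy_bipartite] tw_hairy_bipartite_le[OF assms n(2)]
    by (intro exI[of _ ?G]) (simp add: add_right_mono)
qed

end
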